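(* For every reduced fraction $x\in[1/2,1]$, $$S(x)=(x+2)\,H\!\left(\frac{1}{x+2}\right),$$ equivalently $S(x)=(x+2)\,S\!\left(\frac{1}{x+2}\right)+x\log x-(x+2)\log(x+2)$.
   Context: Farey binary tree: $\ell_1=\{0/1,1/1\}$, $\ell_{n+1}$ = mediants $\frac{p+p'}{q+q'}$ of pairs $p/q<p'/q'$ adjacent in $\bigcup_{i\le n}\ell_i$; each reduced $p/q\in(0,1)$ is the mediant of a unique adjacent pair $p_1/q_1<p_2/q_2$ (its parents). Haros graphs: $G_0$ has two nodes joined by an edge. For ordered-node graphs $G$ ($v_1,\dots,v_a$) and $G'$ ($w_1,\dots,w_b$), $G\oplus G'$ has nodes $u_1,\dots,u_{a+b-1}$ obtained by identifying $v_a$ with $w_1$, keeping all edges, and adding an edge $u_1u_{a+b-1}$. $G_{0/1}=G_{1/1}=G_0$, $G_{p/q}=G_{p_1/q_1}\oplus G_{p_2/q_2}$ ($q+1$ nodes). Degree convention: the first and last nodes are identified into one boundary node whose degree is the sum of their degrees, giving $q$ nodes; $P(k,p/q)$ is the fraction of them with degree $k$. Entropy: $S(x)=-\sum_{k\ge2}P(k,x)\log P(k,x)$, with $0\log0=0$. Reduced entropy: $H(x)=S(x)+2x\log x+(1-2x)\log(1-2x)$ for $x\in[0,1/2]$ and $H(x)=S(x)+2(1-x)\log(1-x)+(2x-1)\log(2x-1)$ for $x\in[1/2,1]$. *)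

theory Defs
  imports "HOL-Analysis.Analysis"
begin

definition num :: "rat \<Rightarrow> int" where
  "num x = fst (quotient_of x)"

definition den :: "rat \<Rightarrow> int" where
  "den x = snd (quotient_of x)"

definition mediant :: "rat \<Rightarrow> rat \<Rightarrow> rat" where
  "mediant r s = Fract (num r + num s) (den r + den s)"

definition adjacent_in :: "rat set \<Rightarrow> rat \<Rightarrow> rat \<Rightarrow> bool" where
  "adjacent_in A r s \<longleftrightarrow> r \<in> A \<and> s \<in> A \<and> r < s \<and> (\<forall>t\<in>A. \<not> (r < t \<and> t < s))"

text \<open>Levels are numbered from 1; level 0 is a dummy.\<close>

fun farey_level :: "nat \<Rightarrow> rat set" where
  "farey_level 0 = {}"
| "farey_level (Suc 0) = {0, 1}"
| "farey_level (Suc (Suc n)) =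
    {mediant r s | r s. adjacent_in (\<Union>i\<in>{1..Suc n}. farey_level i) r s}"

definition farey_upto :: "nat \<Rightarrow> rat set" where
  "farey_upto n = (\<Union>i\<in>{1..n}. farey_level i)"

definition is_parents :: "rat \<Rightarrow> rat \<times> rat \<Rightarrow> bool" where
  "is_parents x = (\<lambda>(r, s). (\<exists>n. adjacent_in (farey_upto n) r s) \<and> x = mediant r s)"

definition parents :: "rat \<Rightarrow> rat \<times> rat" where
  "parents x = (THE rs. is_parents x rs)"

text \<open>
  Existence and uniqueness of the parents of a rational in the open unit interval; this
  justifies the description above and gives termination of the recursion defining the graphs.
\<close>

lemma den_pos: "den x > 0"
  unfolding den_def by (rule quotient_of_denom_pos')

lemma Fract_num_den: "Fract (num x) (den x) = x"
  unfolding num_def den_def by (metis Fract_of_int_quotient prod.collapse quotient_of_div)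

lemma coprime_num_den: "coprime (num x) (den x)"
  unfolding num_def den_def by (metis prod.collapse quotient_of_coprime)

lemma num_den_Fract:
  assumes "coprime a b" "b > 0"
  shows "num (Fract a b) = a" "den (Fract a b) = b"
  using assms by (simp_all add: num_def den_def quotient_of_Fract normalize_stable)

lemma less_iff_num_den: "x < y \<longleftrightarrow> num x * den y < num y * den x"
proof -
  have "Fract (num x) (den x) < Fract (num y) (den y) \<longleftrightarrow>
    (num x * den y) * (den x * den y) < (num y * den x) * (den x * den y)"
    using den_pos[of x] den_pos[of y] by (simp add: mult_ac)
  also have "\<dots> \<longleftrightarrow> num x * den y < num y * den x"
    using den_pos[of x] den_pos[of y] by (intro mult_less_cancel_right_pos mult_pos_pos)
  finally show ?thesis by (simp add: Fract_num_den)
qed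

lemma num_den_0_1 [simp]: "num 0 = 0" "den 0 = 1" "num 1 = 1" "den 1 = 1"
  by (simp_all add: num_def den_def)

definition unimodular :: "rat \<Rightarrow> rat \<Rightarrow> bool" where
  "unimodular r s \<longleftrightarrow> num s * den r - num r * den s = 1"

lemma unimodular_mediant:
  assumes "unimodular r s"
  shows "num (mediant r s) = num r + num s" "den (mediant r s) = den r + den s"
proof -
  have "coprime (num r + num s) (den r + den s)"
  proof (rule coprimeI)
    fix c assume c: "c dvd num r + num s" "c dvd den r + den s"
    have "(num r + num s) * den r - num r * (den r + den s) = 1"
      using assms by (simp add: unimodular_def algebra_simps)
    then show "is_unit c"
      using c by (metis dvd_diff dvd_mult dvd_mult2)
  qed
  then show "num (mediant r s) = num r + num s" "den (mediant r s) = den r + den s"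
    using den_pos[of r] den_pos[of s] by (simp_all add: mediant_def num_den_Fract)
qed

lemma unimodular_mediant_sides:
  assumes "unimodular r s"
  shows "unimodular r (mediant r s)" "unimodular (mediant r s) s"
    "r < mediant r s" "mediant r s < s"
  using assms
  by (simp_all add: unimodular_def unimodular_mediant[OF assms] less_iff_num_den algebra_simps)

lemma unimodular_between:
  assumes "unimodular r s" "r < x" "x < s"
  shows "den r + den s \<le> den x"
proof -
  let ?a = "num x * den r - num r * den x" and ?b = "num s * den x - num x * den s"
  have "?a \<ge> 1" "?b \<ge> 1"
    using assms by (simp_all add: less_iff_num_den)
  then have "1 * den s \<le> ?a * den s" "1 * den r \<le> ?b * den r"
    using den_pos[of s] den_pos[of r] by (auto intro!: mult_right_mono)
  moreover have "?a * den s + ?b * den r = den x * (num s * den r - num r * den s)"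
    by (simp add: algebra_simps)
  ultimately show ?thesis
    using assms(1) by (simp add: unimodular_def)
qed

lemma farey_upto_1: "farey_upto (Suc 0) = {0, 1}"
  by (simp add: farey_upto_def)

lemma farey_upto_Suc:
  "farey_upto (Suc (Suc n)) = farey_upto (Suc n) \<union>
    {mediant r s | r s. adjacent_in (farey_upto (Suc n)) r s}"
  by (auto simp: farey_upto_def atLeastAtMostSuc_conv)

lemma adjacent_in_same:
  assumes "adjacent_in A a b" "adjacent_in A c d" "a < t" "t < b" "c < t" "t < d"
  shows "a = c \<and> b = d"
proof -
  have "c < b" "a < d" using assms by auto
  have "\<not> (a < c \<and> c < b)" "\<not> (c < a \<and> a < d)" "\<not> (a < d \<and> d < b)" "\<not> (c < b \<and> b < d)"
    using assms unfolding adjacent_in_def by blast+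
  then show ?thesis using \<open>c < b\<close> \<open>a < d\<close> by auto
qed

lemma adjacent_in_unimodular_aux:
  "adjacent_in (farey_upto (Suc n)) r s \<Longrightarrow> unimodular r s"
proof (induction n arbitrary: r s)
  case 0
  then show ?case by (auto simp: farey_upto_1 adjacent_in_def unimodular_def)
next
  case (Suc n)
  let ?A = "farey_upto (Suc n)" and ?B = "farey_upto (Suc (Suc n))"
  have new: "a < mediant a b \<and> mediant a b < b \<and> mediant a b \<notin> ?A \<and> mediant a b \<in> ?B"
    if "adjacent_in ?A a b" for a b
    using unimodular_mediant_sides[OF Suc.IH[OF that]] that
    unfolding farey_upto_Suc adjacent_in_def by blast
  have sub: "?A \<subseteq> ?B" by (auto simp: farey_upto_Suc)
  have gap: "\<not> (r < t \<and> t < s)" if "t \<in> ?B" for t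
    using Suc.prems that by (auto simp: adjacent_in_def)
  have rs: "r \<in> ?B" "s \<in> ?B" "r < s" using Suc.prems by (auto simp: adjacent_in_def)
  consider "r \<in> ?A" "s \<in> ?A"
    | c d where "r \<in> ?A" "s = mediant c d" "adjacent_in ?A c d"
    | a b where "r = mediant a b" "adjacent_in ?A a b" "s \<in> ?A"
    | a b c d where "r = mediant a b" "adjacent_in ?A a b" "s = mediant c d" "adjacent_in ?A c d"
    using rs(1,2) unfolding farey_upto_Suc by blast
  then show ?case
  proof cases
    case 1
    then have "adjacent_in ?A r s"
      using rs(3) gap sub unfolding adjacent_in_def by blast
    then show ?thesis using new gap by blast
  next
    case 2
    have "c \<in> ?B" "c < s" "\<not> (c < r \<and> r < d)" "r < d"
      using 2 new[OF 2(3)] sub rs(3) unfolding adjacent_in_def by auto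
    then have "r = c" using gap[of c] by auto
    then show ?thesis using unimodular_mediant_sides(1)[OF Suc.IH[OF 2(3)]] 2 by simp
  next
    case 3
    have "b \<in> ?B" "r < b" "\<not> (a < s \<and> s < b)" "a < s"
      using 3 new[OF 3(2)] sub rs(3) unfolding adjacent_in_def by auto
    then have "s = b" using gap[of b] by auto
    then show ?thesis using unimodular_mediant_sides(2)[OF Suc.IH[OF 3(2)]] 3 by simp
  next
    case 4
    have b: "b \<in> ?A" "b \<in> ?B" using 4 sub unfolding adjacent_in_def by auto
    have "s < b"
      using gap[OF b(2)] new[OF 4(2)] new[OF 4(4)] b 4 by (metis linorder_cases)
    then have "a = c \<and> b = d"
      using new[OF 4(2)] new[OF 4(4)] 4 rs(3) by (intro adjacent_in_same[of ?A a b c d s]) auto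
    then show ?thesis using 4 rs(3) by simp
  qed
qed

lemma adjacent_in_unimodular: "adjacent_in (farey_upto n) r s \<Longrightarrow> unimodular r s"
proof (cases n)
  case 0
  assume "adjacent_in (farey_upto n) r s"
  with 0 show ?thesis by (simp add: adjacent_in_def farey_upto_def)
qed (simp add: adjacent_in_unimodular_aux)

lemma adjacent_in_Suc:
  assumes "adjacent_in (farey_upto (Suc n)) r s"
  shows "adjacent_in (farey_upto (Suc (Suc n))) r (mediant r s)"
    "adjacent_in (farey_upto (Suc (Suc n))) (mediant r s) s"
proof -
  let ?A = "farey_upto (Suc n)" and ?B = "farey_upto (Suc (Suc n))"
  have m: "r < mediant r s" "mediant r s < s"
    using unimodular_mediant_sides adjacent_in_unimodular assms by blast+
  have only: "t = mediant r s" if t: "t \<in> ?B" "r < t" "t < s" for t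
  proof -
    have "t \<notin> ?A" using assms t(2,3) unfolding adjacent_in_def by blast
    then obtain c d where cd: "t = mediant c d" "adjacent_in ?A c d"
      using t(1) unfolding farey_upto_Suc by blast
    then have "c < t" "t < d"
      using unimodular_mediant_sides adjacent_in_unimodular by blast+
    then show ?thesis using adjacent_in_same[OF assms cd(2)] t(2,3) cd(1) by metis
  qed
  have "r \<in> ?B" "s \<in> ?B" "mediant r s \<in> ?B"
    using assms unfolding farey_upto_Suc adjacent_in_def by auto
  then show "adjacent_in ?B r (mediant r s)" "adjacent_in ?B (mediant r s) s"
    using m only unfolding adjacent_in_def by (metis less_trans less_irrefl)+
qed

lemma ex_parents:
  assumes "0 < x" "x < 1"
  shows "\<exists>rs. is_parents x rs"
proof -
  have step: "(\<exists>rs. is_parents x rs) \<or>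
      (\<exists>r s. adjacent_in (farey_upto (Suc n)) r s \<and> r < x \<and> x < s \<and> den r + den s \<ge> int n + 2)"
    for n
  proof (induction n)
    case 0
    have "adjacent_in (farey_upto (Suc 0)) 0 1"
      by (auto simp: farey_upto_1 adjacent_in_def)
    then show ?case using assms by force
  next
    case (Suc n)
    show ?case
    proof (cases "\<exists>rs. is_parents x rs")
      case False
      then obtain r s where rs: "adjacent_in (farey_upto (Suc n)) r s" "r < x" "x < s"
        "den r + den s \<ge> int n + 2" using Suc.IH by auto
      let ?m = "mediant r s"
      have "x \<noteq> ?m" using False rs(1) by (auto simp: is_parents_def)
      moreover have "den ?m = den r + den s"
        using unimodular_mediant adjacent_in_unimodular rs(1) by blast
      then have "den r + den ?m \<ge> int (Suc n) + 2" "den ?m + den s \<ge> int (Suc n) + 2"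
        using rs(4) den_pos[of r] den_pos[of s] by simp_all
      ultimately show ?thesis
        using adjacent_in_Suc[OF rs(1)] rs(2,3) by (metis linorder_cases)
    qed simp
  qed
  show ?thesis
  proof (rule ccontr)
    assume "\<not> ?thesis"
    then obtain r s where rs: "adjacent_in (farey_upto (Suc (nat (den x)))) r s"
      "r < x" "x < s" "den r + den s \<ge> int (nat (den x)) + 2"
      using step[of "nat (den x)"] by auto
    then have "den r + den s \<le> den x"
      using unimodular_between adjacent_in_unimodular by blast
    then show False using rs(4) den_pos[of x] by simp
  qed
qed

lemma is_parents_unique:
  assumes "is_parents x rs" "is_parents x rs'"
  shows "rs = rs'"
proof -
  obtain r s r' s' where eq: "rs = (r, s)" "rs' = (r', s')" by (metis prod.collapse)
  have u: "unimodular r s" "unimodular r' s'" and x: "x = mediant r s" "x = mediant r' s'"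
    using assms adjacent_in_unimodular by (auto simp: is_parents_def eq)
  have d: "den x = den r + den s" "den x = den r' + den s'"
    "num x = num r + num s" "num x = num r' + num s'"
    using unimodular_mediant u x by metis+
  have "unimodular r x" "unimodular r' x"
    using unimodular_mediant_sides(1) u x by metis+
  then have e: "num x * den r - num r * den x = 1" "num x * den r' - num r' * den x = 1"
    by (simp_all add: unimodular_def)
  then have "num x * (den r - den r') = (num r - num r') * den x"
    by (simp add: algebra_simps)
  then have "den x dvd num x * (den r - den r')" by simp
  then have "den x dvd den r - den r'"
    using coprime_num_den[of x] by (simp add: coprime_commute coprime_dvd_mult_right_iff)
  moreover have "\<bar>den r - den r'\<bar> < den x"
    using d den_pos[of r] den_pos[of s] den_pos[of r'] den_pos[of s'] by linarith
  ultimately have den_eq: "den r = den r'"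
    using den_pos[of x] by (metis abs_of_pos dvd_imp_le_int eq_iff_diff_eq_0 not_less)
  have "num r * den x = num r' * den x" using e unfolding den_eq by linarith
  then have num_eq: "num r = num r'" using den_pos[of x] by simp
  have "num s = num s'" "den s = den s'" using d num_eq den_eq by linarith+
  then have "r = r'" "s = s'" using num_eq den_eq Fract_num_den by metis+
  then show ?thesis by (simp add: eq)
qed

lemma is_parents_parents:
  assumes "0 < x" "x < 1"
  shows "is_parents x (parents x)"
  unfolding parents_def using ex_parents[OF assms] is_parents_unique by (metis theI)

lemma den_parents:
  assumes "0 < x" "x < 1"
  shows "den x = den (fst (parents x)) + den (snd (parents x))"
  using is_parents_parents[OF assms] adjacent_in_unimodular unimodular_mediant
  by (auto simp: is_parents_def split: prod.splits)

text \<open>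
  A graph on the ordered nodes \<open>1, \<dots>, a\<close> is the pair of \<open>a\<close> and its set of edges, an edge being
  a two-element set of nodes. In \<open>haros_sum\<close>, node \<open>j\<close> of the second graph becomes
  node \<open>a + j - 1\<close>, so its first node is identified with the last node of the first graph.
\<close>

type_synonym ordered_graph = "nat \<times> nat set set"

definition haros_G0 :: ordered_graph where
  "haros_G0 = (2, {{1, 2}})"

definition haros_sum :: "ordered_graph \<Rightarrow> ordered_graph \<Rightarrow> ordered_graph" where
  "haros_sum = (\<lambda>(a, E) (b, E').
    (a + b - 1, E \<union> (\<lambda>e. (\<lambda>j. a + j - 1) ` e) ` E' \<union> {{1, a + b - 1}}))"

text \<open>Only arguments in the closed unit interval are meaningful.\<close>

function haros_graph :: "rat \<Rightarrow> ordered_graph" where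
  "haros_graph x =
    (if 0 < x \<and> x < 1
     then haros_sum (haros_graph (fst (parents x))) (haros_graph (snd (parents x)))
     else haros_G0)"
  by auto
termination
proof (relation "inv_image less_than (\<lambda>x. nat (den x))")
  fix x :: rat assume x: "0 < x \<and> x < 1"
  then show "(fst (parents x), x) \<in> inv_image less_than (\<lambda>x. nat (den x))"
    "(snd (parents x), x) \<in> inv_image less_than (\<lambda>x. nat (den x))"
    using den_parents[of x] den_pos[of "fst (parents x)"] den_pos[of "snd (parents x)"] by auto
qed auto

declare haros_graph.simps [simp del]

definition node_degree :: "ordered_graph \<Rightarrow> nat \<Rightarrow> nat" where
  "node_degree G v = card {e \<in> snd G. v \<in> e}"

text \<open>
  After identifying the first and the last node, the nodes are \<open>1, \<dots>, a - 1\<close>, with node 1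
  as the boundary node.
\<close>

definition glued_nodes :: "ordered_graph \<Rightarrow> nat set" where
  "glued_nodes G = {1..<fst G}"

definition glued_degree :: "ordered_graph \<Rightarrow> nat \<Rightarrow> nat" where
  "glued_degree G v = (if v = 1 then node_degree G 1 + node_degree G (fst G) else node_degree G v)"

definition degree_dist :: "nat \<Rightarrow> rat \<Rightarrow> real" where
  "degree_dist k x =
    real (card {v \<in> glued_nodes (haros_graph x). glued_degree (haros_graph x) v = k})
      / real (card (glued_nodes (haros_graph x)))"

text \<open>
  The convention \<open>0 log 0 = 0\<close> is automatic. For each \<open>x\<close> the sum has finite support.
\<close>

definition haros_entropy :: "rat \<Rightarrow> real" where
  "haros_entropy x = - (\<Sum>\<^sub>\<infinity>k\<in>{2..}. degree_dist k x * ln (degree_dist k x))"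

text \<open>Both formulas agree at \<open>1/2\<close>.\<close>

definition reduced_entropy :: "rat \<Rightarrow> real" where
  "reduced_entropy x =
    (if x \<le> 1/2
     then haros_entropy x + 2 * of_rat x * ln (of_rat x) + (1 - 2 * of_rat x) * ln (1 - 2 * of_rat x)
     else haros_entropy x + 2 * (1 - of_rat x) * ln (1 - of_rat x)
       + (2 * of_rat x - 1) * ln (2 * of_rat x - 1))"

lemma reduced_entropy_upper:
  assumes "1/2 \<le> x"
  shows "reduced_entropy x = haros_entropy x + 2 * (1 - of_rat x) * ln (1 - of_rat x)
    + (2 * of_rat x - 1) * ln (2 * of_rat x - 1)"
proof (cases "x = 1/2")
  case True
  then have half: "(of_rat x :: real) = 1/2" by (metis of_rat_1 of_rat_divide of_rat_numeral_eq)
  have "x \<le> 1/2" using True by simp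
  then show ?thesis unfolding reduced_entropy_def half by simp
next
  case False
  then show ?thesis using assms by (simp add: reduced_entropy_def)
qed

lemma fst_haros_graph:
  "0 \<le> x \<Longrightarrow> x \<le> 1 \<Longrightarrow> fst (haros_graph x) = nat (den x) + 1"
proof (induction x rule: haros_graph.induct)
  case (1 x)
  show ?case
  proof (cases "0 < x \<and> x < 1")
    case True
    let ?r = "fst (parents x)" and ?s = "snd (parents x)"
    obtain n where "adjacent_in (farey_upto n) ?r ?s"
      using is_parents_parents[of x] True by (auto simp: is_parents_def split: prod.splits)
    moreover have "farey_upto n \<subseteq> {0..1}"
    proof (induction n)
      case (Suc n)
      have "mediant a b \<in> {0..1}" if "adjacent_in (farey_upto n) a b" for a b
        using unimodular_mediant_sides(3,4)[OF adjacent_in_unimodular[OF that]] that Suc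
        unfolding adjacent_in_def by (meson atLeastAtMost_iff less_imp_le order_trans subsetD)
      then show ?case using Suc by (cases n) (auto simp: farey_upto_1 farey_upto_Suc)
    qed (simp add: farey_upto_def)
    ultimately have "?r \<in> {0..1}" "?s \<in> {0..1}" by (auto simp: adjacent_in_def)
    then have "fst (haros_graph ?r) = nat (den ?r) + 1" "fst (haros_graph ?s) = nat (den ?s) + 1"
      using 1 True by auto
    then show ?thesis
      using True den_parents[of x] den_pos[of ?r] den_pos[of ?s]
      by (simp add: haros_graph.simps[of x] haros_sum_def split_beta nat_add_distrib)
  next
    case False
    then have "x = 0 \<or> x = 1" using 1 by auto
    then show ?thesis by (auto simp: haros_graph.simps[of x] haros_G0_def)
  qed
qed

end

theory Submission
  imports Defs
begin

text \<open>
  The map \<open>x \<mapsto> 1/(x+2)\<close> reverses the order and respects mediants, sending \<open>0\<close> to \<open>1/2\<close> and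
  \<open>1\<close> to \<open>1/3\<close>. Hence the Haros graph of \<open>1/(x+2)\<close> is built like that of \<open>x = p/q\<close>, in reversed
  order, with the \<open>p\<close> leaves \<open>1/1\<close> replaced by the graph of \<open>1/3\<close> and the \<open>q - p\<close> leaves \<open>0/1\<close>
  by the graph of \<open>1/2\<close>. The inner nodes of the new leaves contribute \<open>q\<close> nodes of degree 2 and \<open>p\<close>
  nodes of degree 3. The other \<open>q\<close> nodes correspond to those of the graph of \<open>x\<close>, and for
  \<open>x \<ge> 1/2\<close> their degrees are the old ones transformed by a map that is injective on the degrees
  that occur, with values above 3. The two entropies are therefore related by a grouping computation.
\<close>

section \<open>Parents and graphs of mediants of unimodular pairs\<close>

text \<open>Lets graphs be decomposed along any unimodular pair, without tracking Farey levels. Two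
  such pairs with mediant \<open>x\<close> agree: if their left ends were \<open>a < c\<close>, then
  \<open>c\<close> would lie strictly between the unimodular pair \<open>a\<close>, \<open>x\<close>
  and have a denominator above that of \<open>x\<close>, whereas both ends have smaller denominators
  than their mediant. The right ends are treated symmetrically.\<close>

lemma parents_mediant:
  assumes "unimodular r s" "0 < mediant r s" "mediant r s < 1"
  shows "parents (mediant r s) = (r, s)"
proof -
  let ?x = "mediant r s"
  obtain r' s' where p: "parents ?x = (r', s')" by (metis prod.collapse)
  have u: "unimodular r' s'" "mediant r' s' = ?x"
    using is_parents_parents[OF assms(2,3)] adjacent_in_unimodular
    by (auto simp: is_parents_def p)
  have le: "den a < den ?x" "den b < den ?x" if "unimodular a b" "mediant a b = ?x" for a b
    using unimodular_mediant(2)[OF that(1)] that(2) den_pos[of a] den_pos[of b] by simp_all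
  have "\<not> a < c" "\<not> d < b"
    if "unimodular a b" "mediant a b = ?x" "unimodular c d" "mediant c d = ?x" for a b c d
    using unimodular_mediant_sides[OF that(1)] unimodular_mediant_sides[OF that(3)]
      unimodular_between[of a ?x c] unimodular_between[of ?x b d] le[OF that(3,4)] that
      den_pos[of a] den_pos[of b] by fastforce+
  from this[OF assms(1) refl u] this[OF u assms(1) refl] have "r = r'" "s = s'" by simp_all
  then show ?thesis using p by simp
qed

lemma haros_graph_mediant:
  assumes "unimodular r s" "0 \<le> r" "s \<le> 1"
  shows "haros_graph (mediant r s) = haros_sum (haros_graph r) (haros_graph s)"
proof -
  have "0 < mediant r s" "mediant r s < 1"
    using unimodular_mediant_sides(3,4)[OF assms(1)] assms(2,3) by auto
  then show ?thesis
    using parents_mediant[OF assms(1)] by (simp add: haros_graph.simps[of "mediant r s"])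
qed

lemma num_den_half: "num (1/2) = 1" "den (1/2) = 2"
proof -
  have "(1/2 :: rat) = Fract 1 2" by (simp add: Fract_of_int_quotient)
  then show "num (1/2) = 1" "den (1/2) = 2"
    using num_den_Fract[of 1 2] by (simp_all only: coprime_1_left zero_less_numeral)
qed

lemma rat_eqI_num_den: "num x = num y \<Longrightarrow> den x = den y \<Longrightarrow> x = y"
  by (metis Fract_num_den)

lemma half_eq_mediant: "mediant 0 1 = 1/2"
  by (simp add: mediant_def Fract_of_int_quotient)

text \<open>Induction on the denominator through the parents of \<open>x\<close>. Neither 1/2 nor 1
  can lie strictly between the parents, since its denominator is less than the sum of theirs; so the
  parents stay in the interval.\<close>

lemma farey_upper_half_induct [consumes 2, case_names one half mediant]:
  assumes "1/2 \<le> x" "x \<le> 1"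
    and one: "P 1" and half: "P (1/2)"
    and step: "\<And>r s. unimodular r s \<Longrightarrow> 1/2 \<le> r \<Longrightarrow> r < s \<Longrightarrow> s \<le> 1 \<Longrightarrow> P r \<Longrightarrow> P s \<Longrightarrow>
      P (mediant r s)"
  shows "P x"
  using assms(1,2)
proof (induction "nat (den x)" arbitrary: x rule: less_induct)
  case less
  consider "x = 1" | "x = 1/2" | "1/2 < x" "x < 1" using less.prems by fastforce
  then show ?case
  proof cases
    case 3
    then have "0 < x" by (meson less_trans zero_less_divide_1_iff zero_less_numeral)
    then obtain r s where rs: "unimodular r s" "x = mediant r s"
      using is_parents_parents[of x] 3(2)
      by (auto simp: is_parents_def split: prod.splits dest: adjacent_in_unimodular)
    have d: "den x = den r + den s" and o: "r < x" "x < s" "r < s"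
      using unimodular_mediant(2) unimodular_mediant_sides(3,4) rs by force+
    \<comment> \<open>Otherwise \<open>x\<close> would have denominator 2, but no such fraction lies
      strictly between 1/2 and 1. The strict bound is what keeps 1/2 from separating the
      parents.\<close>
    have "den r + den s > 2"
    proof (rule ccontr)
      assume "\<not> ?thesis"
      then have "den x = 2" "den r = 1" "den s = 1"
        using d den_pos[of r] den_pos[of s] by linarith+
      then show False
        using 3 by (simp add: less_iff_num_den num_den_half)
    qed
    then have "1/2 \<le> r"
      using unimodular_between[OF rs(1), of "1/2"] o 3
      by (simp add: num_den_half) (meson less_trans not_le)
    moreover have "s \<le> 1"
      using unimodular_between[OF rs(1), of 1] o 3 den_pos[of r] den_pos[of s]
      by (simp add: not_less[symmetric]) (smt (verit) less_trans)
    ultimately show ?thesis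
      using step[OF rs(1) _ o(3)] less.hyps[of r] less.hyps[of s] d o rs den_pos[of r] den_pos[of s]
      by auto
  qed (simp_all only: one half)
qed

section \<open>The map \<open>1/(x+2)\<close> on Farey fractions\<close>

definition farey_flip :: "rat \<Rightarrow> rat" where
  "farey_flip x = 1 / (x + 2)"

text \<open>The integer matrix with rows (0, 1) and (1, 2) has determinant -1. So it keeps coprime
  pairs coprime, reverses unimodular pairs and, being linear, respects mediants.\<close>

lemma num_den_farey_flip:
  assumes "0 \<le> x"
  shows "num (farey_flip x) = den x" "den (farey_flip x) = num x + 2 * den x"
proof -
  have n: "0 \<le> num x"
    using assms less_iff_num_den[of x 0] by auto
  have "x = of_int (num x) / of_int (den x)"
    by (metis Fract_num_den Fract_of_int_quotient)
  then have "farey_flip x = 1 / (of_int (num x) / of_int (den x) + 2)"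
    unfolding farey_flip_def by simp
  also have "\<dots> = of_int (den x) / of_int (num x + 2 * den x)"
    using den_pos[of x] n by (simp add: field_simps)
  also have "\<dots> = Fract (den x) (num x + 2 * den x)"
    by (simp only: Fract_of_int_quotient)
  finally have eq: "farey_flip x = Fract (den x) (num x + 2 * den x)" .
  have "coprime (den x) (num x + 2 * den x)"
    using coprime_num_den[of x]
    by (metis add.commute coprime_commute coprime_iff_gcd_eq_1 gcd_add_mult)
  moreover have "num x + 2 * den x > 0" using n den_pos[of x] by simp
  ultimately show "num (farey_flip x) = den x" "den (farey_flip x) = num x + 2 * den x"
    unfolding eq by (rule num_den_Fract)+
qed

lemma unimodular_farey_flip:
  assumes "unimodular r s" "0 \<le> r" "0 \<le> s"
  shows "unimodular (farey_flip s) (farey_flip r)"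
  using assms by (simp add: unimodular_def num_den_farey_flip algebra_simps)

lemma mediant_farey_flip:
  assumes "unimodular r s" "0 \<le> r" "0 \<le> s"
  shows "mediant (farey_flip s) (farey_flip r) = farey_flip (mediant r s)"
proof -
  have "0 \<le> mediant r s" using unimodular_mediant_sides(3)[OF assms(1)] assms(2) by simp
  then show ?thesis
    using unimodular_mediant[OF unimodular_farey_flip[OF assms]] assms
    by (intro rat_eqI_num_den) (simp_all add: num_den_farey_flip unimodular_mediant)
qed

lemma haros_graph_farey_flip_mediant:
  assumes "unimodular r s" "0 \<le> r" "0 \<le> s"
  shows "haros_graph (farey_flip (mediant r s)) =
    haros_sum (haros_graph (farey_flip s)) (haros_graph (farey_flip r))"
proof -
  have "0 \<le> farey_flip s" "farey_flip r \<le> 1"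
    using assms by (simp_all add: farey_flip_def)
  then show ?thesis
    using haros_graph_mediant[OF unimodular_farey_flip[OF assms]] mediant_farey_flip[OF assms]
    by simp
qed

section \<open>Degrees in sums of ordered graphs\<close>

text \<open>The invariant that makes the three edge sets united in \<open>haros_sum\<close>
  disjoint, so that degrees simply add.\<close>

definition wf_graph :: "ordered_graph \<Rightarrow> bool" where
  "wf_graph G \<longleftrightarrow> 2 \<le> fst G \<and> finite (snd G) \<and> (\<forall>e\<in>snd G. e \<subseteq> {1..fst G} \<and> card e = 2)"

lemma wf_haros_G0: "wf_graph haros_G0"
  by (simp add: wf_graph_def haros_G0_def)

lemma wf_haros_sum:
  assumes "wf_graph G" "wf_graph H"
  shows "wf_graph (haros_sum G H)"
proof -
  obtain a E b F where G: "G = (a, E)" and H: "H = (b, F)" by (metis prod.collapse)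
  have ab: "2 \<le> a" "2 \<le> b" using assms by (auto simp: wf_graph_def G H)
  then have inj: "inj (\<lambda>j. a + j - 1)" by (auto simp: inj_on_def)
  have "e \<subseteq> {1..a + b - 1} \<and> card e = 2" if "e \<in> E" for e
    using assms(1) that ab by (fastforce simp: wf_graph_def G)
  moreover have "(\<lambda>j. a + j - 1) ` e \<subseteq> {1..a + b - 1} \<and> card ((\<lambda>j. a + j - 1) ` e) = 2"
    if "e \<in> F" for e
    using assms(2) that ab card_image[OF inj_on_subset[OF inj subset_UNIV], of e]
    by (fastforce simp: wf_graph_def H)
  ultimately show ?thesis
    using assms ab by (auto simp: wf_graph_def haros_sum_def G H)
qed

lemma wf_haros_graph: "wf_graph (haros_graph x)"
proof (induction x rule: haros_graph.induct)
  case (1 x)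
  then show ?case
    by (subst haros_graph.simps) (simp add: wf_haros_G0 wf_haros_sum)
qed

lemma node_degree_outside:
  assumes "wf_graph G" "v \<notin> {1..fst G}"
  shows "node_degree G v = 0"
proof -
  have "{e \<in> snd G. v \<in> e} = {}" using assms unfolding wf_graph_def by blast
  then show ?thesis unfolding node_degree_def by (simp only: card.empty)
qed

text \<open>Truncated subtraction: for \<open>v < fst G\<close> the second summand is the degree of the non-node 0.\<close>

lemma node_degree_haros_sum:
  assumes "wf_graph G" "wf_graph H"
  shows "node_degree (haros_sum G H) v = node_degree G v + node_degree H (v + 1 - fst G)
    + (if v = 1 \<or> v = fst G + fst H - 1 then 1 else 0)"
proof -
  obtain a E b F where G: "G = (a, E)" and H: "H = (b, F)" by (metis prod.collapse)
  have ab: "2 \<le> a" "2 \<le> b" and fin: "finite E" "finite F"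
    and E: "\<And>e. e \<in> E \<Longrightarrow> e \<subseteq> {1..a} \<and> card e = 2"
    and F: "\<And>e. e \<in> F \<Longrightarrow> e \<subseteq> {1..b} \<and> card e = 2"
    using assms by (auto simp: wf_graph_def G H)
  let ?sh = "\<lambda>j. a + j - 1"
  have inj: "inj ?sh" using ab by (auto simp: inj_on_def)
  let ?F = "(`) ?sh ` F"
  have F': "f \<subseteq> {a..a + b - 1} \<and> card f = 2" if f: "f \<in> ?F" for f
  proof -
    obtain e where e: "e \<in> F" "f = ?sh ` e" using f by auto
    then show ?thesis
      using F[OF e(1)] card_image[OF inj_on_subset[OF inj subset_UNIV], of e] by fastforce
  qed
  \<comment> \<open>The two blocks share only the node \<open>a\<close>, which cannot hold a
    two-element edge.\<close>
  have EF: "E \<inter> ?F = {}"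
  proof -
    { fix e assume e: "e \<in> E" "e \<in> ?F"
      then have "e \<subseteq> {1..a} \<inter> {a..a + b - 1}" using E F' by blast
      then have "e \<subseteq> {a}" by auto
      then have "card e \<le> 1" using card_mono[of "{a}" e] by simp
      then have False using E[OF e(1)] by simp }
    then show ?thesis by blast
  qed
  \<comment> \<open>The closing edge leaves both blocks: node 1 is not in the second one as
    \<open>a\<close> is at least 2, and \<open>a + b - 1\<close> is not in the first one as
    \<open>b\<close> is at least 2.\<close>
  have new: "{1, a + b - 1} \<notin> E \<union> ?F"
    using E[of "{1, a + b - 1}"] F'[of "{1, a + b - 1}"] ab by auto
  have shift: "card {e \<in> ?F. v \<in> e} = card {e \<in> F. v + 1 - a \<in> e}"
  proof -
    have "{e \<in> ?F. v \<in> e} = (`) ?sh ` {e \<in> F. v + 1 - a \<in> e}"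
    proof -
      have "v \<in> ?sh ` e \<longleftrightarrow> v + 1 - a \<in> e" if "e \<in> F" for e
      proof
        assume "v + 1 - a \<in> e"
        moreover from this have "v + 1 - a \<ge> 1" using F[OF that] by auto
        ultimately show "v \<in> ?sh ` e" by (intro image_eqI[of _ _ "v + 1 - a"]) auto
      next
        assume "v \<in> ?sh ` e"
        then obtain j where "j \<in> e" "v = a + j - 1" by auto
        then show "v + 1 - a \<in> e" using ab by simp
      qed
      then show ?thesis by blast
    qed
    moreover have "inj_on ((`) ?sh) {e \<in> F. v + 1 - a \<in> e}"
      by (rule inj_onI) (simp only: inj_image_eq_iff[OF inj])
    ultimately show ?thesis by (simp only: card_image)
  qed
  have "{e \<in> E \<union> ?F \<union> {{1, a + b - 1}}. v \<in> e} = ({e \<in> E. v \<in> e} \<union> {e \<in> ?F. v \<in> e})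
    \<union> (if v = 1 \<or> v = a + b - 1 then {{1, a + b - 1}} else {})"
    by auto
  also have "card \<dots> = card ({e \<in> E. v \<in> e} \<union> {e \<in> ?F. v \<in> e})
    + card (if v = 1 \<or> v = a + b - 1 then {{1, a + b - 1}} else {})"
    using fin new by (intro card_Un_disjoint) auto
  also have "card ({e \<in> E. v \<in> e} \<union> {e \<in> ?F. v \<in> e}) = card {e \<in> E. v \<in> e} + card {e \<in> ?F. v \<in> e}"
    using fin EF by (intro card_Un_disjoint) auto
  finally show ?thesis
    unfolding node_degree_def haros_sum_def G H shift by simp
qed

definition first_degree :: "ordered_graph \<Rightarrow> nat" where
  "first_degree G = node_degree G 1"

definition last_degree :: "ordered_graph \<Rightarrow> nat" where
  "last_degree G = node_degree G (fst G)"

text \<open>A multiset, since only the number of nodes of each degree matters for the entropy. The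
  two end nodes are kept apart because further sums still change their degrees.\<close>

definition inner_degrees :: "ordered_graph \<Rightarrow> nat multiset" where
  "inner_degrees G = image_mset (node_degree G) (mset_set {2..<fst G})"

definition glued_degrees :: "ordered_graph \<Rightarrow> nat multiset" where
  "glued_degrees G = add_mset (first_degree G + last_degree G) (inner_degrees G)"

text \<open>Each outer end gains the closing edge, the shared node becomes inner, and every other
  inner node lies in one block only and keeps its degree.\<close>

lemma degrees_haros_sum:
  assumes "wf_graph G" "wf_graph H"
  shows "first_degree (haros_sum G H) = first_degree G + 1"
    "last_degree (haros_sum G H) = last_degree H + 1"
    "inner_degrees (haros_sum G H) =
      add_mset (last_degree G + first_degree H) (inner_degrees G + inner_degrees H)"
proof -
  let ?a = "fst G" and ?b = "fst H"
  have ab: "2 \<le> ?a" "2 \<le> ?b" using assms by (auto simp: wf_graph_def)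
  have n: "fst (haros_sum G H) = ?a + ?b - 1" by (simp add: haros_sum_def split_beta)
  note D = node_degree_haros_sum[OF assms] and out = node_degree_outside
  show "first_degree (haros_sum G H) = first_degree G + 1"
    using ab out[OF assms(2), of 0] by (simp add: first_degree_def D)
  show "last_degree (haros_sum G H) = last_degree H + 1"
  proof -
    have "?a + ?b - 1 \<notin> {1..?a}" using ab by auto
    from out[OF assms(1) this] show ?thesis using ab by (simp add: last_degree_def D n)
  qed
  \<comment> \<open>The shift is written \<open>?a - 1 + j\<close>, not \<open>?a + j - 1\<close>,
    to match \<open>image_add_atLeastLessThan\<close>.\<close>
  have split: "{2..<?a + ?b - 1} = insert ?a ({2..<?a} \<union> (\<lambda>j. ?a - 1 + j) ` {2..<?b})"
  proof -
    have "(\<lambda>j. ?a - 1 + j) ` {2..<?b} = {?a + 1..<?a + ?b - 1}"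
      using ab by (subst image_add_atLeastLessThan) auto
    then show ?thesis using ab by auto
  qed
  have "mset_set {2..<?a + ?b - 1} =
      add_mset ?a (mset_set {2..<?a} + image_mset (\<lambda>j. ?a - 1 + j) (mset_set {2..<?b}))"
  proof -
    have "{2..<?a} \<inter> (\<lambda>j. ?a - 1 + j) ` {2..<?b} = {}" using ab by auto
    moreover have "?a \<notin> {2..<?a} \<union> (\<lambda>j. ?a - 1 + j) ` {2..<?b}" using ab by auto
    ultimately show ?thesis
      unfolding split by (simp add: mset_set_Union image_mset_mset_set inj_on_def del: Un_iff)
  qed
  moreover have "image_mset (node_degree (haros_sum G H)) (mset_set {2..<?a}) = inner_degrees G"
    unfolding inner_degrees_def
    using ab out[OF assms(2), of 0] by (intro image_mset_cong) (auto simp: D)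
  moreover have "image_mset (\<lambda>j. node_degree (haros_sum G H) (?a - 1 + j)) (mset_set {2..<?b})
      = inner_degrees H"
    unfolding inner_degrees_def
    using ab by (intro image_mset_cong) (auto simp: D intro!: out[OF assms(1)])
  moreover have "node_degree (haros_sum G H) ?a = last_degree G + first_degree H"
    using ab by (simp add: D last_degree_def first_degree_def)
  ultimately show "inner_degrees (haros_sum G H) =
      add_mset (last_degree G + first_degree H) (inner_degrees G + inner_degrees H)"
    by (simp add: inner_degrees_def n image_mset.compositionality comp_def)
qed

section \<open>Degrees of the base graphs\<close>

lemma degrees_haros_G0:
  "first_degree haros_G0 = 1" "last_degree haros_G0 = 1" "inner_degrees haros_G0 = {#}"
proof -
  have "{e. e = {Suc 0, 2} \<and> v \<in> e} = {{Suc 0, 2}}" if "v = Suc 0 \<or> v = 2" for v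
    using that by auto
  then show "first_degree haros_G0 = 1" "last_degree haros_G0 = 1" "inner_degrees haros_G0 = {#}"
    by (simp_all add: first_degree_def last_degree_def inner_degrees_def node_degree_def haros_G0_def)
qed

lemmas degrees_haros_graph_sum = degrees_haros_sum[OF wf_haros_graph wf_haros_graph]

lemma degrees_haros_graph_0:
  "first_degree (haros_graph 0) = 1" "last_degree (haros_graph 0) = 1" "inner_degrees (haros_graph 0) = {#}"
  by (simp_all add: haros_graph.simps[of 0] degrees_haros_G0)

lemma degrees_haros_graph_1:
  "first_degree (haros_graph 1) = 1" "last_degree (haros_graph 1) = 1" "inner_degrees (haros_graph 1) = {#}"
  by (simp_all add: haros_graph.simps[of 1] degrees_haros_G0)

lemma degrees_haros_graph_half:
  "first_degree (haros_graph (1/2)) = 2" "last_degree (haros_graph (1/2)) = 2"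
  "inner_degrees (haros_graph (1/2)) = {#2#}"
proof -
  have "haros_graph (1/2) = haros_sum (haros_graph 0) (haros_graph 1)"
    using haros_graph_mediant[of 0 1] by (simp add: unimodular_def half_eq_mediant)
  then show "first_degree (haros_graph (1/2)) = 2" "last_degree (haros_graph (1/2)) = 2"
    "inner_degrees (haros_graph (1/2)) = {#2#}"
    by (simp_all add: degrees_haros_graph_sum degrees_haros_graph_0 degrees_haros_graph_1 numeral_2_eq_2)
qed

lemma degrees_farey_flip_0:
  "first_degree (haros_graph (farey_flip 0)) = 2" "last_degree (haros_graph (farey_flip 0)) = 2"
  "inner_degrees (haros_graph (farey_flip 0)) = {#2#}"
  by (simp_all add: farey_flip_def degrees_haros_graph_half)

text \<open>The parents of 1/3 are 0 and 1/2. Its last node has degree 3, not 2 as for 1/2; this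
  asymmetry is the source of the later case distinction on \<open>x = 1\<close>.\<close>

lemma degrees_farey_flip_1:
  "first_degree (haros_graph (farey_flip 1)) = 2" "last_degree (haros_graph (farey_flip 1)) = 3"
  "inner_degrees (haros_graph (farey_flip 1)) = {#3, 2#}"
proof -
  have "mediant 0 (1/2) = farey_flip 1"
    by (simp add: mediant_def num_den_half Fract_of_int_quotient farey_flip_def)
  then have "haros_graph (farey_flip 1) = haros_sum (haros_graph 0) (haros_graph (1/2))"
    using haros_graph_mediant[of 0 "1/2"] by (simp add: unimodular_def num_den_half)
  then show "first_degree (haros_graph (farey_flip 1)) = 2" "last_degree (haros_graph (farey_flip 1)) = 3"
    "inner_degrees (haros_graph (farey_flip 1)) = {#3, 2#}"
    by (simp_all add: degrees_haros_graph_sum degrees_haros_graph_0 degrees_haros_graph_half)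
qed

lemma degrees_farey_flip_half:
  "first_degree (haros_graph (farey_flip (1/2))) = 3" "last_degree (haros_graph (farey_flip (1/2))) = 3"
  "inner_degrees (haros_graph (farey_flip (1/2))) = {#5, 3, 2, 2#}"
proof -
  have "haros_graph (farey_flip (1/2)) = haros_sum (haros_graph (farey_flip 1)) (haros_graph (farey_flip 0))"
    using haros_graph_farey_flip_mediant[of 0 1] by (simp add: unimodular_def half_eq_mediant)
  then show "first_degree (haros_graph (farey_flip (1/2))) = 3" "last_degree (haros_graph (farey_flip (1/2))) = 3"
    "inner_degrees (haros_graph (farey_flip (1/2))) = {#5, 3, 2, 2#}"
    by (simp_all add: degrees_haros_graph_sum degrees_farey_flip_0 degrees_farey_flip_1)
qed

lemmas degrees_base = degrees_haros_graph_1 degrees_haros_graph_half degrees_farey_flip_1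
  degrees_farey_flip_half

section \<open>Comparison of the degrees for \<open>x\<close> and \<open>1/(x+2)\<close>\<close>

text \<open>Both 3 and 4 go to 6, so injectivity rests on these degrees never occurring together: in
  the range considered, 4 occurs only as the boundary degree at \<open>x = 1/2\<close>.\<close>

definition flip_degree :: "nat \<Rightarrow> nat" where
  "flip_degree k = (if k \<le> 3 then k + 3 else k + 2)"

text \<open>
  A node at which two blocks are joined gains degree 3 if the right-hand block is the leaf \<open>1/1\<close>,
  and degree 2 otherwise; when \<open>x \<ge> 1/2\<close> the former are exactly the nodes of degree at most 3.
\<close>

lemma degrees_upper_half:
  assumes "1/2 \<le> x" "x \<le> 1"
  shows "(1/2 < x \<and> x < 1 \<longrightarrow> 3 \<le> first_degree (haros_graph x))
    \<and> (x < 1 \<longrightarrow> 2 \<le> last_degree (haros_graph x))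
    \<and> (den x - num x = 1 \<longrightarrow> last_degree (haros_graph x) = 2)
    \<and> set_mset (inner_degrees (haros_graph x)) \<subseteq> {2, 3} \<union> {5..}
    \<and> last_degree (haros_graph (farey_flip x)) = first_degree (haros_graph x) + (if x = 1 then 2 else 1)
    \<and> first_degree (haros_graph (farey_flip x)) = last_degree (haros_graph x) + 1
    \<and> inner_degrees (haros_graph (farey_flip x)) =
        replicate_mset (nat (den x)) 2 + replicate_mset (nat (num x)) 3
        + image_mset flip_degree (inner_degrees (haros_graph x))"
  using assms
proof (induction rule: farey_upper_half_induct)
  case one
  show ?case by (simp add: degrees_base)
next
  case half
  show ?case by (simp add: degrees_base num_den_half flip_degree_def numeral_2_eq_2)
next
  case (mediant r s)
  let ?m = "mediant r s"
  have r: "0 \<le> r" "r < 1" "0 \<le> s" "1/2 < s" using mediant(2-4) by auto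
  have m: "1/2 < ?m" "?m < 1"
    using unimodular_mediant_sides(3,4)[OF mediant(1)] mediant(2-4) by auto
  note D = haros_graph_mediant[OF mediant(1) r(1) mediant(4)]
    haros_graph_farey_flip_mediant[OF mediant(1) r(1,3)] degrees_haros_graph_sum
  have pos: "0 \<le> num r" "0 \<le> num s" "0 < den r" "0 < den s"
    using r less_iff_num_den[of r 0] less_iff_num_den[of s 0] den_pos by auto
  then have nat: "nat (num ?m) = nat (num r) + nat (num s)" "nat (den ?m) = nat (den r) + nat (den s)"
    by (simp_all add: unimodular_mediant[OF mediant(1)] nat_add_distrib)
  have defect: "num r < den r" "s < 1 \<Longrightarrow> num s < den s"
    using less_iff_num_den[of r 1] less_iff_num_den[of s 1] r by auto
  have IH: "1/2 < r \<Longrightarrow> 3 \<le> first_degree (haros_graph r)"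
    "s < 1 \<Longrightarrow> 3 \<le> first_degree (haros_graph s)"
    "2 \<le> last_degree (haros_graph r)" "s < 1 \<Longrightarrow> 2 \<le> last_degree (haros_graph s)"
    "den r - num r = 1 \<Longrightarrow> last_degree (haros_graph r) = 2"
    "set_mset (inner_degrees (haros_graph r)) \<subseteq> {2, 3} \<union> {5..}"
    "set_mset (inner_degrees (haros_graph s)) \<subseteq> {2, 3} \<union> {5..}"
    using mediant.IH r by blast+
  have "r \<noteq> 1" using r(2) by simp
  then have IH_last: "last_degree (haros_graph (farey_flip r)) = first_degree (haros_graph r) + 1"
    "last_degree (haros_graph (farey_flip s)) = first_degree (haros_graph s) + (if s = 1 then 2 else 1)"
    using mediant.IH by presburger+
  have IH_flip: "first_degree (haros_graph (farey_flip r)) = last_degree (haros_graph r) + 1"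
    "first_degree (haros_graph (farey_flip s)) = last_degree (haros_graph s) + 1"
    "inner_degrees (haros_graph (farey_flip r)) =
        replicate_mset (nat (den r)) 2 + replicate_mset (nat (num r)) 3
        + image_mset flip_degree (inner_degrees (haros_graph r))"
    "inner_degrees (haros_graph (farey_flip s)) =
        replicate_mset (nat (den s)) 2 + replicate_mset (nat (num s)) 3
        + image_mset flip_degree (inner_degrees (haros_graph s))"
    using mediant.IH by blast+
  \<comment> \<open>Unimodularity with \<open>s = 1\<close> reads \<open>den r - num r = 1\<close>;
    the third clause of the induction exists for this case.\<close>
  have one: "last_degree (haros_graph r) = 2" if "s = 1"
    using IH(5) mediant(1) that by (simp add: unimodular_def)
  \<comment> \<open>At \<open>r = 1/2\<close> the first degree is only 2, which suffices because the
    closing edge adds one.\<close>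
  have first: "2 \<le> first_degree (haros_graph r)"
  proof (cases "r = 1/2")
    case True
    show ?thesis unfolding True by (simp add: degrees_base)
  next
    case False
    then have "1/2 < r" using mediant(2) by (simp only: less_le) simp
    then show ?thesis using IH(1) by linarith
  qed
  have last: "1 \<le> last_degree (haros_graph s)"
    using IH(4) mediant(4) by (cases "s = 1") (simp_all add: degrees_base)
  let ?d = "last_degree (haros_graph r) + first_degree (haros_graph s)"
  have d: "?d \<in> {2, 3} \<union> {5..}"
    "last_degree (haros_graph (farey_flip s)) + first_degree (haros_graph (farey_flip r)) = flip_degree ?d"
  proof -
    \<comment> \<open>The joint degree is 2 + 1 = 3 if the right block is the leaf 1, and at least 2
      + 3 = 5 otherwise. So 4 is skipped, and the threshold in \<open>flip_degree\<close> detects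
      the leaf.\<close>
    consider "s = 1" | "s < 1" using mediant(4) by fastforce
    then have "?d \<in> {2, 3} \<union> {5..} \<and>
      last_degree (haros_graph (farey_flip s)) + first_degree (haros_graph (farey_flip r)) = flip_degree ?d"
    proof cases
      case 1
      have "first_degree (haros_graph 1) = 1" by (simp add: degrees_base)
      then show ?thesis
        using one[OF 1] IH_last(2) IH_flip(1) by (simp add: 1 flip_degree_def)
    next
      case 2
      then show ?thesis
        using IH(2,3) IH_last(2) IH_flip(1) by (simp add: flip_degree_def)
    qed
    then show "?d \<in> {2, 3} \<union> {5..}"
      "last_degree (haros_graph (farey_flip s)) + first_degree (haros_graph (farey_flip r)) = flip_degree ?d"
      by blast+
  qed
  \<comment> \<open>The difference \<open>den - num\<close> adds up over the parents and is at least
    1 for each parent below 1; as \<open>r < 1\<close>, the total 1 forces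
    \<open>s = 1\<close>.\<close>
  have defect_last: "last_degree (haros_graph s) = 1" if "den ?m - num ?m = 1"
  proof -
    have "\<not> s < 1"
      using that defect unfolding unimodular_mediant[OF mediant(1)] by linarith
    then have "s = 1" using mediant(4) by simp
    then show ?thesis by (simp add: degrees_base)
  qed
  have rep: "replicate_mset (m + n) k = replicate_mset m k + replicate_mset n k" for m n and k :: nat
    by (simp add: multiset_eq_iff)
  have inner: "inner_degrees (haros_graph (farey_flip ?m)) =
      replicate_mset (nat (den ?m)) 2 + replicate_mset (nat (num ?m)) 3
      + image_mset flip_degree (inner_degrees (haros_graph ?m))"
    unfolding D d(2) nat rep unfolding IH_flip(3,4) by simp
  have "set_mset (inner_degrees (haros_graph ?m)) \<subseteq> {2, 3} \<union> {5..}"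
    unfolding D using IH(6,7) d(1) by simp
  moreover have "first_degree (haros_graph ?m) = first_degree (haros_graph r) + 1"
    "last_degree (haros_graph ?m) = last_degree (haros_graph s) + 1"
    "last_degree (haros_graph (farey_flip ?m)) = last_degree (haros_graph (farey_flip r)) + 1"
    "first_degree (haros_graph (farey_flip ?m)) = first_degree (haros_graph (farey_flip s)) + 1"
    by (simp_all only: D)
  ultimately show ?case
    using m first last defect_last IH_last(1) IH_flip(2) inner by (intro conjI impI) simp_all
qed

text \<open>For \<open>1/2 < x < 1\<close> each end gains degree one, which agrees with
  \<open>flip_degree\<close> as the boundary degree is at least 3 + 2. The end points have boundary
  degrees 4 and 2 and are computed directly.\<close>

lemma glued_degrees_farey_flip:
  assumes "1/2 \<le> x" "x \<le> 1"
  defines "D \<equiv> glued_degrees (haros_graph x)"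
  shows "glued_degrees (haros_graph (farey_flip x)) =
      replicate_mset (nat (den x)) 2 + replicate_mset (nat (num x)) 3 + image_mset flip_degree D"
    "inj_on flip_degree (set_mset D)" "set_mset D \<subseteq> {2..}"
proof -
  let ?b = "first_degree (haros_graph x) + last_degree (haros_graph x)"
  note deg = degrees_upper_half[OF assms(1,2)]
  consider "x = 1" | "x = 1/2" | "1/2 < x" "x < 1" using assms by fastforce
  then have b: "first_degree (haros_graph (farey_flip x)) + last_degree (haros_graph (farey_flip x))
      = flip_degree ?b \<and> inj_on flip_degree (set_mset D) \<and> set_mset D \<subseteq> {2..}"
  proof cases
    case 1
    show ?thesis
      unfolding D_def 1 by (simp add: glued_degrees_def degrees_base flip_degree_def)
  next
    case 2
    show ?thesis
      unfolding D_def 2 by (simp add: glued_degrees_def degrees_base flip_degree_def)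
  next
    case 3
    then have "3 \<le> first_degree (haros_graph x)" "2 \<le> last_degree (haros_graph x)"
      using deg by blast+
    then have b: "5 \<le> ?b" by linarith
    moreover have "set_mset (inner_degrees (haros_graph x)) \<subseteq> {2, 3} \<union> {5..}"
      using deg by blast
    ultimately have sub: "set_mset D \<subseteq> {2, 3} \<union> {5..}"
      by (simp add: D_def glued_degrees_def)
    moreover have "inj_on flip_degree ({2, 3} \<union> {5..})"
      by (auto simp: inj_on_def flip_degree_def)
    ultimately have "inj_on flip_degree (set_mset D)" by (rule inj_on_subset[rotated])
    moreover have "set_mset D \<subseteq> {2..}" by (rule order_trans[OF sub]) auto
    moreover have "x \<noteq> 1" using 3(2) by simp
    then have "last_degree (haros_graph (farey_flip x)) = first_degree (haros_graph x) + 1"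
      "first_degree (haros_graph (farey_flip x)) = last_degree (haros_graph x) + 1"
      using deg by presburger+
    then have "first_degree (haros_graph (farey_flip x)) + last_degree (haros_graph (farey_flip x))
        = flip_degree ?b"
      using b by (simp add: flip_degree_def)
    ultimately show ?thesis by blast
  qed
  show "glued_degrees (haros_graph (farey_flip x)) =
      replicate_mset (nat (den x)) 2 + replicate_mset (nat (num x)) 3 + image_mset flip_degree D"
    using b deg unfolding D_def glued_degrees_def by simp
  show "inj_on flip_degree (set_mset D)" "set_mset D \<subseteq> {2..}" using b by auto
qed

section \<open>Entropies expressed by degree counts\<close>

text \<open>Unnormalised: with \<open>q\<close> nodes, the entropy is \<open>ln q\<close> minus this
  sum divided by \<open>q\<close>. Unlike the entropy, this sum is additive over multisets with
  disjoint supports.\<close>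

definition count_entropy :: "nat multiset \<Rightarrow> real" where
  "count_entropy D = (\<Sum>k\<in>set_mset D. real (count D k) * ln (real (count D k)))"

text \<open>Node 1 represents both ends after gluing, and the remaining glued nodes are the inner
  ones.\<close>

lemma glued_degrees_eq:
  assumes "wf_graph G"
  shows "glued_degrees G = image_mset (glued_degree G) (mset_set (glued_nodes G))"
proof -
  have "2 \<le> fst G" using assms by (simp add: wf_graph_def)
  then have "{1..<fst G} = insert 1 {2..<fst G}" by auto
  moreover have "image_mset (glued_degree G) (mset_set {2..<fst G}) = inner_degrees G"
    unfolding inner_degrees_def by (intro image_mset_cong) (auto simp: glued_degree_def)
  ultimately show ?thesis
    by (simp add: glued_degrees_def glued_nodes_def glued_degree_def first_degree_def last_degree_def)
qed

lemma degree_dist_eq: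
  assumes "0 \<le> x" "x \<le> 1"
  shows "degree_dist k x = real (count (glued_degrees (haros_graph x)) k) / real_of_int (den x)"
proof -
  have "{v \<in> glued_nodes (haros_graph x). glued_degree (haros_graph x) v = k}
      = glued_nodes (haros_graph x) \<inter> glued_degree (haros_graph x) -` {k}" by auto
  moreover have "count (glued_degrees (haros_graph x)) k =
      card (glued_degree (haros_graph x) -` {k} \<inter> glued_nodes (haros_graph x))"
    by (simp add: glued_degrees_eq[OF wf_haros_graph] count_image_mset glued_nodes_def)
  ultimately show ?thesis
    using fst_haros_graph[OF assms] den_pos[of x]
    by (simp add: degree_dist_def glued_nodes_def Int_commute)
qed

lemma sum_count_glued_degrees:
  assumes "0 \<le> x" "x \<le> 1"
  shows "(\<Sum>k\<in>set_mset (glued_degrees (haros_graph x)). real (count (glued_degrees (haros_graph x)) k))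
    = real_of_int (den x)"
proof -
  have "size (glued_degrees (haros_graph x)) = nat (den x)"
    using fst_haros_graph[OF assms]
    by (simp add: glued_degrees_eq[OF wf_haros_graph] glued_nodes_def)
  then show ?thesis
    using den_pos[of x] by (simp add: size_multiset_overloaded_eq flip: of_nat_sum)
qed

lemma haros_entropy_eq:
  assumes "0 \<le> x" "x \<le> 1" "set_mset (glued_degrees (haros_graph x)) \<subseteq> {2..}"
  shows "haros_entropy x = ln (real_of_int (den x))
    - count_entropy (glued_degrees (haros_graph x)) / real_of_int (den x)"
proof -
  let ?D = "glued_degrees (haros_graph x)" and ?q = "real_of_int (den x)"
  have q: "?q > 0" using den_pos[of x] by simp
  have "(\<Sum>\<^sub>\<infinity>k\<in>{2..}. degree_dist k x * ln (degree_dist k x)) =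
      (\<Sum>\<^sub>\<infinity>k\<in>set_mset ?D. degree_dist k x * ln (degree_dist k x))"
    \<comment> \<open>No degree below 2 occurs, so no occurring degree is lost, and the terms of all
      other degrees vanish.\<close>
    using assms(3)
    by (intro infsum_cong_neutral) (auto simp: degree_dist_eq[OF assms(1,2)] not_in_iff)
  also have "\<dots> = (\<Sum>k\<in>set_mset ?D. degree_dist k x * ln (degree_dist k x))"
    by simp
  also have "\<dots> = (\<Sum>k\<in>set_mset ?D. real (count ?D k) * ln (real (count ?D k)) / ?q
      - real (count ?D k) * (ln ?q / ?q))"
    using q by (intro sum.cong)
      (auto simp: degree_dist_eq[OF assms(1,2)] ln_div diff_divide_distrib right_diff_distrib)
  \<comment> \<open>The counts sum to \<open>?q\<close>, which turns the second part into
    \<open>ln ?q\<close>.\<close>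
  also have "\<dots> = count_entropy ?D / ?q - ln ?q"
    using q by (simp add: sum_subtractf count_entropy_def sum_count_glued_degrees[OF assms(1,2)]
        flip: sum_divide_distrib sum_distrib_right)
  finally show ?thesis by (simp add: haros_entropy_def)
qed

lemma count_entropy_plus:
  assumes "set_mset A \<inter> set_mset B = {}"
  shows "count_entropy (A + B) = count_entropy A + count_entropy B"
proof -
  have "count B k = 0" if "k \<in># A" for k using assms that by (auto simp: not_in_iff)
  moreover have "count A k = 0" if "k \<in># B" for k using assms that by (auto simp: not_in_iff)
  ultimately show ?thesis
    using assms by (simp add: count_entropy_def sum.union_disjoint)
qed

lemma count_entropy_replicate: "count_entropy (replicate_mset n k) = real n * ln (real n)"
  by (simp add: count_entropy_def)

lemma count_entropy_image:
  assumes "inj_on f (set_mset D)"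
  shows "count_entropy (image_mset f D) = count_entropy D"
proof -
  have "f -` {f k} \<inter> set_mset D = {k}" if "k \<in># D" for k
    using assms that by (auto dest: inj_onD)
  then show ?thesis
    using assms by (simp add: count_entropy_def sum.reindex count_image_mset)
qed

lemma count_entropy_glued_degrees_farey_flip:
  assumes "1/2 \<le> x" "x \<le> 1"
  shows "count_entropy (glued_degrees (haros_graph (farey_flip x))) =
      real_of_int (den x) * ln (real_of_int (den x)) + real_of_int (num x) * ln (real_of_int (num x))
      + count_entropy (glued_degrees (haros_graph x))"
    "set_mset (glued_degrees (haros_graph (farey_flip x))) \<subseteq> {2..}"
proof -
  let ?D = "glued_degrees (haros_graph x)"
  note g = glued_degrees_farey_flip[OF assms]
  \<comment> \<open>Old degrees are at least 2, so their images avoid the new degrees 2 and 3 and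
    the three contributions add.\<close>
  have "5 \<le> flip_degree k" if "k \<in># ?D" for k
    using g(3) that by (auto simp: flip_degree_def)
  then have image: "set_mset (image_mset flip_degree ?D) \<subseteq> {5..}" by auto
  have "0 \<le> x" using assms(1) by (rule order_trans[rotated]) simp
  then have num: "0 \<le> num x" using less_iff_num_den[of x 0] by auto
  show "set_mset (glued_degrees (haros_graph (farey_flip x))) \<subseteq> {2..}"
    unfolding g(1) using image by auto
  have "(set_mset (replicate_mset (nat (den x)) 2) \<union> set_mset (replicate_mset (nat (num x)) 3))
      \<inter> set_mset (image_mset flip_degree ?D) = {}"
    using image by (auto simp: subset_iff)
  then show "count_entropy (glued_degrees (haros_graph (farey_flip x))) =
      real_of_int (den x) * ln (real_of_int (den x)) + real_of_int (num x) * ln (real_of_int (num x))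
      + count_entropy ?D"
    unfolding g(1) using num den_pos[of x]
    by (subst count_entropy_plus, simp, subst count_entropy_plus)
       (auto simp: count_entropy_replicate count_entropy_image[OF g(2)])
qed

section \<open>The entropy identities\<close>

text \<open>The factor \<open>x + 2\<close> is the ratio \<open>(p + 2q)/q\<close> of the node
  counts. Multiplying by it gives \<open>T\<close> the same denominator \<open>q\<close> in both
  entropies, so \<open>T\<close> cancels.\<close>

lemma haros_entropy_farey_flip:
  assumes "1/2 \<le> x" "x \<le> 1"
  shows "haros_entropy x = (of_rat x + 2) * haros_entropy (farey_flip x)
      + of_rat x * ln (of_rat x) - (of_rat x + 2) * ln (of_rat x + 2)"
proof -
  define p q T where "p = real_of_int (num x)" and "q = real_of_int (den x)"
    and "T = count_entropy (glued_degrees (haros_graph x))"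
  have x: "0 < x" using assms(1) by (rule less_le_trans[rotated]) simp
  then have "0 < num x" using less_iff_num_den[of 0 x] by auto
  then have pq: "0 < p" "0 < q" using den_pos[of x] by (auto simp: p_def q_def)
  have flip: "0 \<le> farey_flip x" "farey_flip x \<le> 1" using x by (simp_all add: farey_flip_def)
  note ent = count_entropy_glued_degrees_farey_flip[OF assms]
  have S: "haros_entropy x = ln q - T / q"
    using haros_entropy_eq[OF _ assms(2) glued_degrees_farey_flip(3)[OF assms]] x
    by (simp add: q_def T_def)
  have S': "haros_entropy (farey_flip x) = ln (p + 2 * q) - (q * ln q + p * ln p + T) / (p + 2 * q)"
    using haros_entropy_eq[OF flip ent(2)] ent(1) num_den_farey_flip[of x] x
    by (simp add: p_def q_def T_def)
  have xpq: "(of_rat x :: real) = p / q"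
    by (metis Fract_num_den of_rat_rat den_pos less_irrefl p_def q_def)
  have x2: "p / q + 2 = (p + 2 * q) / q" using pq by (simp add: field_simps)
  have lns: "ln (p / q) = ln p - ln q" "ln ((p + 2 * q) / q) = ln (p + 2 * q) - ln q"
    using pq by (simp_all add: ln_div)
  show ?thesis
  proof -
    have "(p + 2 * q) / q * haros_entropy (farey_flip x) =
        ((p + 2 * q) * ln (p + 2 * q) - (q * ln q + p * ln p + T)) / q"
      using pq by (simp add: S' right_diff_distrib diff_divide_distrib)
    then show ?thesis
      unfolding S xpq x2 lns using pq by (simp add: add_divide_distrib diff_divide_distrib algebra_simps)
  qed
qed

text \<open>With \<open>y = 1/(x+2)\<close>, the nodes of degree 2, those of degree 3 and the rest
  have weights \<open>y\<close>, \<open>1 - 2y\<close> and \<open>y\<close>. The correction terms in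
  the reduced entropy subtract exactly the entropy of this grouping.\<close>

lemma reduced_entropy_farey_flip:
  assumes "0 < x"
  shows "(of_rat x + 2) * reduced_entropy (farey_flip x) = (of_rat x + 2) * haros_entropy (farey_flip x)
      + of_rat x * ln (of_rat x) - (of_rat x + 2) * ln (of_rat x + 2)"
proof -
  define t :: real where "t = of_rat x"
  have t: "0 < t" using assms by (simp add: t_def)
  \<comment> \<open>Selects the lower branch of \<open>reduced_entropy\<close>.\<close>
  have le: "farey_flip x \<le> 1/2" using assms by (simp add: farey_flip_def field_simps)
  have y: "of_rat (farey_flip x) = 1 / (t + 2)"
    by (simp add: farey_flip_def t_def of_rat_divide of_rat_add)
  have z: "1 - 2 * (1 / (t + 2)) = t / (t + 2)" using t by (simp add: field_simps)
  have H: "reduced_entropy (farey_flip x) = haros_entropy (farey_flip x)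
      - 2 / (t + 2) * ln (t + 2) + t / (t + 2) * (ln t - ln (t + 2))"
    using le t unfolding reduced_entropy_def y z by (simp add: ln_div)
  have "(t + 2) * reduced_entropy (farey_flip x) = (t + 2) * haros_entropy (farey_flip x) - 2 * ln (t + 2) + t * (ln t - ln (t + 2))"
    unfolding H using t by (simp add: right_diff_distrib distrib_left)
  then show ?thesis
    unfolding t_def[symmetric] by (simp add: algebra_simps)
qed

theorem theorem14:
  fixes x :: rat
  assumes "1/2 \<le> x" and "x \<le> 1"
  shows "haros_entropy x = (of_rat x + 2) * reduced_entropy (1 / (x + 2)) \<and>
    haros_entropy x = (of_rat x + 2) * haros_entropy (1 / (x + 2))
      + of_rat x * ln (of_rat x) - (of_rat x + 2) * ln (of_rat x + 2)"
proof -
  have "0 < x" using assms(1) by (rule less_le_trans[rotated]) simp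
  then show ?thesis
    using haros_entropy_farey_flip[OF assms] reduced_entropy_farey_flip[of x]
    by (simp add: farey_flip_def)
qed

end
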